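(* Let $E$ be a (real) Banach lattice and let $m\ge 2$. A regular $m$-linear form $A\colon E^m\to\mathbb{R}$ is orthosymmetric if and only if $$A(x_1,\dots,x_m)=A\bigl(J_1^m(x),\dots,J_m^m(x)\bigr)$$ for every $x=(x_1,\dots,x_m)\in E^m$.
   Context: An $m$-linear form $A\colon E^m\to\mathbb{R}$ is positive if $A(x_1,\dots,x_m)\ge0$ for all $x_1,\dots,x_m\in E_+$, and regular if it is a difference of two positive $m$-linear forms. A regular $m$-linear form $A$ is orthosymmetric if $A(x_1,\dots,x_m)=0$ whenever some pair $x_i,x_j$ ($i\ne j$) of the arguments is disjoint, i.e. $|x_i|\wedge|x_j|=0$. For $x=(x_1,\dots,x_m)\in E^m$ and $1\le k\le m$, $$J_k^m(x)=\bigvee_{1\le i_1<i_2<\dots<i_k\le m}\bigl(x_{i_1}\wedge x_{i_2}\wedge\dots\wedge x_{i_k}\bigr)\in E;$$ in particular $J_1^m(x)=x_1\vee\dots\vee x_m$ and $J_m^m(x)=x_1\wedge\dots\wedge x_m$. *)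

theory Defs
  imports "HOL-Analysis.Analysis" "HOL-Library.Lattice_Algebras" "HOL-Library.FuncSet"
begin

class banach_lattice = banach + ordered_real_vector + lattice_ab_group_add_abs +
  assumes norm_mono_abs: "\<bar>x\<bar> \<le> \<bar>y\<bar> \<Longrightarrow> norm x \<le> norm y"

instance real :: banach_lattice
  by standard simp

definition lattice_disjoint :: "'a::banach_lattice \<Rightarrow> 'a \<Rightarrow> bool" where
  "lattice_disjoint x y \<longleftrightarrow> inf \<bar>x\<bar> \<bar>y\<bar> = 0"

text \<open>
  The power \<open>E\<^sup>m\<close> is the set of functions on \<open>{1..m}\<close> (extensional, i.e. \<open>undefined\<close> elsewhere),
  so that the number of arguments \<open>m\<close> is an ordinary natural number. Forms on \<open>E\<^sup>m\<close> are total
  HOL functions of which only the values on this set matter.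
\<close>

definition power_space :: "nat \<Rightarrow> (nat \<Rightarrow> 'a) set" where
  "power_space m = {1..m} \<rightarrow>\<^sub>E UNIV"

definition multilinear_form :: "nat \<Rightarrow> ((nat \<Rightarrow> 'a::real_vector) \<Rightarrow> real) \<Rightarrow> bool" where
  "multilinear_form m A \<longleftrightarrow>
     (\<forall>x\<in>power_space m. \<forall>i\<in>{1..m}. linear (\<lambda>t. A (x(i := t))))"

definition positive_form :: "nat \<Rightarrow> ((nat \<Rightarrow> 'a::banach_lattice) \<Rightarrow> real) \<Rightarrow> bool" where
  "positive_form m A \<longleftrightarrow> multilinear_form m A \<and>
     (\<forall>x\<in>power_space m. (\<forall>i\<in>{1..m}. 0 \<le> x i) \<longrightarrow> 0 \<le> A x)"

definition regular_form :: "nat \<Rightarrow> ((nat \<Rightarrow> 'a::banach_lattice) \<Rightarrow> real) \<Rightarrow> bool" where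
  "regular_form m A \<longleftrightarrow>
     (\<exists>P Q. positive_form m P \<and> positive_form m Q \<and> (\<forall>x\<in>power_space m. A x = P x - Q x))"

definition orthosymmetric :: "nat \<Rightarrow> ((nat \<Rightarrow> 'a::banach_lattice) \<Rightarrow> real) \<Rightarrow> bool" where
  "orthosymmetric m A \<longleftrightarrow> regular_form m A \<and>
     (\<forall>x\<in>power_space m.
        (\<exists>i\<in>{1..m}. \<exists>j\<in>{1..m}. i \<noteq> j \<and> lattice_disjoint (x i) (x j)) \<longrightarrow> A x = 0)"

text \<open>
  Index tuples \<open>i\<^sub>1 < \<dots> < i\<^sub>k\<close> are encoded as the \<open>k\<close>-element subsets of \<open>{1..m}\<close>. The value is
  meaningful only for \<open>1 \<le> k \<le> m\<close>, where all suprema and infima are over finite nonempty sets.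
\<close>

definition J :: "nat \<Rightarrow> nat \<Rightarrow> (nat \<Rightarrow> 'a::lattice) \<Rightarrow> 'a" where
  "J m k x = Sup_fin ((\<lambda>I. Inf_fin (x ` I)) ` {I. I \<subseteq> {1..m} \<and> card I = k})"

end

theory Submission
  imports Defs
begin

text \<open>
  An orthosymmetric regular form is symmetric in any two arguments. With
  \<open>u = (y - x)\<^sup>+\<close> and \<open>v = (x - y)\<^sup>+\<close>, so that \<open>x \<squnion> y = x + u\<close>, \<open>x \<sqinter> y = x - v\<close> and \<open>u\<close>, \<open>v\<close> are
  disjoint, symmetry implies that replacing two arguments by their supremum and infimum does not
  change the value of the form. Since vector lattices are distributive, these replacements preserve
  every \<open>J\<^sub>k\<close>, and finitely many of them turn the arguments into a decreasing chain, whose \<open>k\<close>-th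
  entry is its \<open>J\<^sub>k\<close>. Conversely, \<open>J\<^sub>m\<close> vanishes on positive arguments of which two are disjoint.
\<close>

section \<open>Symmetry of orthosymmetric bilinear forms\<close>

text \<open>Translating \<open>inf z 0\<close> by \<open>pprt (- z)\<close> gives the infimum of the
  two parts, and the translate is \<open>nprt z - nprt z\<close>.\<close>

lemma inf_pprt_uminus:
  fixes z :: "'a::lattice_ab_group_add"
  shows "inf (pprt z) (pprt (- z)) = 0"
proof -
  have "pprt z = z + pprt (- z)"
    using prts[of z] by (simp add: pprt_neg algebra_simps)
  then have "inf (pprt z) (pprt (- z)) = nprt z + pprt (- z)"
    using add_inf_distrib_right[of z 0 "pprt (- z)"] by (simp add: nprt_def)
  then show ?thesis by (simp add: pprt_neg)
qed

text \<open>Truncation at \<open>e\<close> removes the excess \<open>pprt (pprt z - e)\<close>,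
  which is \<open>pprt (z - e)\<close> because \<open>e\<close> is nonnegative. In this form sums of
  truncations telescope.\<close>

lemma inf_pprt_left:
  fixes e z :: "'a::lattice_ab_group_add"
  assumes "0 \<le> e"
  shows "inf (pprt z) e = pprt z - pprt (z - e)"
proof -
  have "sup (sup z 0 - e) 0 = sup (sup (z - e) (- e)) 0"
    using add_sup_distrib_right[of z 0 "- e"] by simp
  also have "\<dots> = sup (z - e) 0"
    using assms by (simp add: sup_assoc sup_absorb2)
  finally have "pprt (pprt z - e) = pprt (z - e)"
    by (simp add: pprt_def)
  moreover have "w - pprt (w - e) = inf w e" for w
    using add_inf_distrib_left[of w "e - w" 0] by (simp add: pprt_def inf_commute)
  ultimately show ?thesis by metis
qed

lemma inf_eq_0_mono:
  fixes a b c d :: "'a::lattice_ab_group_add"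
  assumes "inf c d = 0" "0 \<le> a" "a \<le> c" "0 \<le> b" "b \<le> d"
  shows "inf a b = 0"
  using assms inf_mono[of a c b d] by (simp add: order.antisym)

text \<open>Horizontal slicing: for \<open>k \<ge> 1\<close>, \<open>b k\<close> is the part of
  \<open>n x\<close> between the heights \<open>(k - 1) e\<close> and \<open>k e\<close>. A slice
  lives only where the one below it is full, hence the disjointness; since
  \<open>n x \<le> n e\<close>, the slices \<open>1\<close> to \<open>n\<close> add up to
  \<open>n x\<close>.\<close>

lemma slices_exist:
  fixes x e :: "'a::{ordered_real_vector, lattice_ab_group_add}"
  assumes "0 \<le> x" "x \<le> e"
  obtains b :: "nat \<Rightarrow> 'a" where
    "b 0 = e" "\<And>k. 0 \<le> b k" "\<And>k. b k \<le> e" "\<And>k. b (Suc k) \<le> b k"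
    "\<And>k. inf (b (Suc k)) (e - b k) = 0" "(\<Sum>k<n. b (Suc k)) = real n *\<^sub>R x"
proof
  have e: "0 \<le> e" using assms by simp
  \<comment> \<open>The extra \<open>e\<close> shifts the numbering: \<open>y 1\<close> is
    \<open>n x\<close>, and slice \<open>0\<close> is all of \<open>e\<close>, so that differences
    of consecutive slices telescope from \<open>e\<close>.\<close>
  define y where "y k = real n *\<^sub>R x + e - real k *\<^sub>R e" for k
  have y_Suc: "y (Suc k) = y k - e" for k
    by (simp add: y_def algebra_simps)
  define b where "b k = inf (pprt (y k)) e" for k
  have nx: "0 \<le> real n *\<^sub>R x" using assms by (simp add: scaleR_nonneg_nonneg)
  have "e \<le> y 0" using nx by (simp add: y_def)
  also have "y 0 \<le> pprt (y 0)" by (simp add: pprt_def)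
  finally show "b 0 = e" by (simp add: b_def inf_absorb2)
  show "0 \<le> b k" "b k \<le> e" for k using e by (auto simp: b_def)
  show "b (Suc k) \<le> b k" for k
    unfolding b_def y_Suc using e by (intro inf_mono pprt_mono) auto
  have b: "b k = pprt (y k) - pprt (y (Suc k))" for k
    using inf_pprt_left[OF e] by (simp add: b_def y_Suc)
  \<comment> \<open>The two elements lie below the positive and the negative part of the same
    \<open>y (Suc k)\<close>.\<close>
  show "inf (b (Suc k)) (e - b k) = 0" for k
  proof (rule inf_eq_0_mono)
    show "inf (pprt (y (Suc k))) (pprt (- y (Suc k))) = 0" by (rule inf_pprt_uminus)
    have "b k \<le> e" by (simp add: b_def)
    then show "0 \<le> e - b k" by simp
    show "0 \<le> b (Suc k)" using e by (simp add: b_def)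
    show "b (Suc k) \<le> pprt (y (Suc k))" by (simp add: b_def)
    have "e - b k = sup (e - pprt (y k)) 0"
      using add_sup_distrib_left[of e "- pprt (y k)" "- e"] by (simp add: b_def)
    also have "\<dots> \<le> sup (e - y k) 0"
      by (intro sup_mono diff_left_mono) (auto simp: pprt_def)
    finally show "e - b k \<le> pprt (- y (Suc k))"
      by (simp add: pprt_def y_Suc)
  qed
  have "(\<Sum>k<n. b (Suc k)) = pprt (y 1) - pprt (y (Suc n))"
    unfolding b by (induction n) auto
  also have "pprt (y 1) = real n *\<^sub>R x"
    using nx by (simp add: y_def)
  also have "y (Suc n) = real n *\<^sub>R x - real n *\<^sub>R e"
    by (simp add: y_def algebra_simps)
  then have "pprt (y (Suc n)) = 0"
    using assms by (simp add: scaleR_left_mono)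
  finally show "(\<Sum>k<n. b (Suc k)) = real n *\<^sub>R x" by simp
qed

text \<open>
  The slices \<open>b\<close> of \<open>n x\<close> are orthogonal to \<open>e - b\<close> of the preceding level, so that in the
  antisymmetrization of \<open>B\<close> the argument \<open>e\<close> may be replaced by a difference of consecutive
  slices. These differences telescope, which gives a bound for \<open>n\<close> times the commutator that does
  not depend on \<open>n\<close>.
\<close>
lemma orthosymmetric_bilinear_commute_le:
  fixes B R :: "'a::{ordered_real_vector, lattice_ab_group_add} \<Rightarrow> 'a \<Rightarrow> real"
  assumes B: "\<And>s. linear (B s)" "\<And>t. linear (\<lambda>s. B s t)"
    and R: "\<And>s. linear (R s)" "\<And>t. linear (\<lambda>s. R s t)"
    and le: "\<And>s t. 0 \<le> s \<Longrightarrow> 0 \<le> t \<Longrightarrow> \<bar>B s t\<bar> \<le> R s t"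
    and disj: "\<And>s t. 0 \<le> s \<Longrightarrow> 0 \<le> t \<Longrightarrow> inf s t = 0 \<Longrightarrow> B s t = 0"
    and x: "0 \<le> x" "x \<le> e"
  shows "B x e = B e x"
proof -
  have e: "0 \<le> e" using x by simp
  note [simp] = linear_diff[OF B(1)] linear_diff[OF B(2)] linear_diff[OF R(1)] linear_diff[OF R(2)]
  have R_nonneg: "0 \<le> R s t" if "0 \<le> s" "0 \<le> t" for s t
    using le[OF that] by simp
  have bound: "real n * \<bar>B x e - B e x\<bar> \<le> 2 * R e e" for n
  proof -
    obtain b where b: "b 0 = e" "\<And>k. 0 \<le> b k" "\<And>k. b k \<le> e" "\<And>k. b (Suc k) \<le> b k"
        "\<And>k. inf (b (Suc k)) (e - b k) = 0" "(\<Sum>k<n. b (Suc k)) = real n *\<^sub>R x"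
      using slices_exist[OF x, of n] by blast
    \<comment> \<open>Both summands are linear in the difference of consecutive slices, so the sum
      of the \<open>d k\<close> telescopes and stays below \<open>2 * R e e\<close> for every
      \<open>n\<close>.\<close>
    define d where "d k = R e (b k - b (Suc k)) + R (b k - b (Suc k)) e" for k
    have step: "\<bar>B (b (Suc k)) e - B e (b (Suc k))\<bar> \<le> d k" for k
    proof -
      have "B (b (Suc k)) (e - b k) = 0" "B (e - b k) (b (Suc k)) = 0"
        using b(2,3,5) by (intro disj; simp add: inf_commute)+
      \<comment> \<open>Orthogonality replaces \<open>e\<close> by \<open>b k\<close> in both terms;
        then \<open>B (b (Suc k)) (b (Suc k))\<close> is subtracted from each.\<close>
      then have eq: "B (b (Suc k)) e - B e (b (Suc k))
          = B (b (Suc k)) (b k - b (Suc k)) - B (b k - b (Suc k)) (b (Suc k))"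
        by simp
      have pos: "0 \<le> b k - b (Suc k)" "0 \<le> e - b (Suc k)"
        using b(3,4) by simp_all
      have "\<bar>B (b (Suc k)) (b k - b (Suc k))\<bar> \<le> R e (b k - b (Suc k))"
        using le[OF b(2) pos(1), of "Suc k"] R_nonneg[OF pos(2) pos(1)] by simp
      moreover have "\<bar>B (b k - b (Suc k)) (b (Suc k))\<bar> \<le> R (b k - b (Suc k)) e"
        using le[OF pos(1) b(2), of "Suc k"] R_nonneg[OF pos(1) pos(2)] by simp
      ultimately show ?thesis unfolding eq d_def by linarith
    qed
    have "real n * (B x e - B e x) = B (\<Sum>k<n. b (Suc k)) e - B e (\<Sum>k<n. b (Suc k))"
      unfolding b(6) by (simp add: linear_cmul[OF B(1)] linear_cmul[OF B(2)] algebra_simps)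
    also have "\<dots> = (\<Sum>k<n. B (b (Suc k)) e - B e (b (Suc k)))"
      by (simp add: linear_sum[OF B(1)] linear_sum[OF B(2)] sum_subtractf)
    finally have "real n * \<bar>B x e - B e x\<bar> = \<bar>\<Sum>k<n. B (b (Suc k)) e - B e (b (Suc k))\<bar>"
      by (metis abs_mult abs_of_nat)
    also have "\<dots> \<le> (\<Sum>k<n. d k)"
      by (rule order_trans[OF sum_abs]) (intro sum_mono step)
    also have "\<dots> = R e (e - b n) + R (e - b n) e"
      unfolding d_def by (induction n) (simp_all add: b(1) linear_0[OF R(1)] linear_0[OF R(2)])
    also have "\<dots> \<le> 2 * R e e"
      using R_nonneg[OF e b(2), of n] R_nonneg[OF b(2) e, of n] by simp
    finally show ?thesis .
  qed
  show ?thesis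
  proof (rule ccontr)
    assume "B x e \<noteq> B e x"
    then obtain n where "2 * R e e < real n * \<bar>B x e - B e x\<bar>"
      using reals_Archimedean3[of "\<bar>B x e - B e x\<bar>"] by auto
    with bound[of n] show False by simp
  qed
qed

text \<open>For nonnegative \<open>s\<close> and \<open>t\<close>, commuting \<open>s\<close> with
  its upper bound \<open>s + t\<close> produces \<open>B s s\<close> on both sides; cancelling it
  leaves \<open>B s t = B t s\<close>. Positive and negative parts extend this to all
  elements.\<close>

lemma orthosymmetric_bilinear_symmetric:
  fixes B R :: "'a::{ordered_real_vector, lattice_ab_group_add} \<Rightarrow> 'a \<Rightarrow> real"
  assumes B: "\<And>s. linear (B s)" "\<And>t. linear (\<lambda>s. B s t)"
    and R: "\<And>s. linear (R s)" "\<And>t. linear (\<lambda>s. R s t)"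
    and le: "\<And>s t. 0 \<le> s \<Longrightarrow> 0 \<le> t \<Longrightarrow> \<bar>B s t\<bar> \<le> R s t"
    and disj: "\<And>s t. 0 \<le> s \<Longrightarrow> 0 \<le> t \<Longrightarrow> inf s t = 0 \<Longrightarrow> B s t = 0"
  shows "B x y = B y x"
proof -
  have pos: "B s t = B t s" if "0 \<le> s" "0 \<le> t" for s t
  proof -
    have "B s (s + t) = B (s + t) s"
      using that by (intro orthosymmetric_bilinear_commute_le[OF B R le disj]) auto
    then show ?thesis
      by (simp add: linear_add[OF B(1)] linear_add[OF B(2)])
  qed
  have half: "B s t = B t s" if "0 \<le> s" for s t
  proof -
    have t: "t = pprt t - pprt (- t)" using prts[of t] by (simp add: pprt_neg)
    show ?thesis
      by (subst (1 2) t)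
        (simp add: linear_diff[OF B(1)] linear_diff[OF B(2)] pos[OF that] del: pprt_eq_0 pprt_eq_id)
  qed
  have x: "x = pprt x - pprt (- x)" using prts[of x] by (simp add: pprt_neg)
  show ?thesis
    by (subst (1 2) x)
      (simp add: linear_diff[OF B(1)] linear_diff[OF B(2)] half[of "pprt _" y])
qed

lemma orthosymmetric_bilinear_sup_inf:
  fixes B R :: "'a::{ordered_real_vector, lattice_ab_group_add} \<Rightarrow> 'a \<Rightarrow> real"
  assumes B: "\<And>s. linear (B s)" "\<And>t. linear (\<lambda>s. B s t)"
    and R: "\<And>s. linear (R s)" "\<And>t. linear (\<lambda>s. R s t)"
    and le: "\<And>s t. 0 \<le> s \<Longrightarrow> 0 \<le> t \<Longrightarrow> \<bar>B s t\<bar> \<le> R s t"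
    and disj: "\<And>s t. 0 \<le> s \<Longrightarrow> 0 \<le> t \<Longrightarrow> inf s t = 0 \<Longrightarrow> B s t = 0"
  shows "B (sup x y) (inf x y) = B x y"
proof -
  define u v where "u = pprt (y - x)" and "v = pprt (- (y - x))"
  have "inf u v = 0" unfolding u_def v_def by (rule inf_pprt_uminus)
  then have uv: "B u v = 0" by (intro disj) (auto simp: u_def v_def)
  have v: "v = - nprt (y - x)" by (simp only: v_def pprt_neg)
  have "u - v = y - x" by (simp add: u_def v prts[of "y - x", symmetric])
  then have y: "y = x + u - v" by (simp add: algebra_simps)
  have "sup x y = x + u"
    using add_sup_distrib_left[of x "y - x" 0] by (simp add: u_def pprt_def sup_commute)
  moreover have "inf x y = x - v"
    using add_inf_distrib_left[of x "y - x" 0] by (simp add: v nprt_def inf_commute)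
  ultimately have "B (sup x y) (inf x y) = B (x + u) (x - v)" by simp
  also have "\<dots> = B x x - B x v + B u x"
    using uv by (simp add: linear_add[OF B(2)] linear_diff[OF B(1)])
  \<comment> \<open>Symmetry brings \<open>x\<close> into the first argument of every term, so that
    the terms collect in the second.\<close>
  also have "B u x = B x u" by (rule orthosymmetric_bilinear_symmetric[OF B R le disj])
  also have "B x x - B x v + B x u = B x (x + u - v)"
    by (simp add: linear_add[OF B(1)] linear_diff[OF B(1)])
  finally show ?thesis by (simp only: y[symmetric])
qed

section \<open>Sorting by comparators\<close>

text \<open>The compare-exchange gate of a sorting network. Entries may be incomparable, so it need
  not permute them; the supremum goes to \<open>i\<close>, which for \<open>i < j\<close> sorts
  downwards.\<close>

definition comparator :: "nat \<Rightarrow> nat \<Rightarrow> (nat \<Rightarrow> 'a::lattice) \<Rightarrow> nat \<Rightarrow> 'a" where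
  "comparator i j x = x(i := sup (x i) (x j), j := inf (x i) (x j))"

text \<open>Selection sort: the outer induction makes position \<open>n + 1\<close> dominate all
  later ones, the inner one applies the gates \<open>(n + 1, p + 1)\<close> in turn. The invariant
  \<open>P\<close> carries whatever the gates preserve.\<close>

lemma comparator_sorting:
  fixes x :: "nat \<Rightarrow> 'a::lattice"
  assumes "P x"
    and step: "\<And>x i j. P x \<Longrightarrow> i \<in> {1..m} \<Longrightarrow> j \<in> {1..m} \<Longrightarrow> i < j \<Longrightarrow> P (comparator i j x)"
  obtains y where "P y" "antimono_on {1..m} y"
proof -
  define D where "D y n p \<longleftrightarrow> (\<forall>j\<in>{1..p}. n < j \<longrightarrow> y j \<le> y n)" for y :: "nat \<Rightarrow> 'a" and n p
  have "\<exists>y. P y \<and> (\<forall>i\<in>{1..n}. D y i m)" if "n \<le> m" for n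
    using that
  proof (induction n)
    case 0
    then show ?case using assms(1) by auto
  next
    case (Suc n)
    have "\<exists>y. P y \<and> (\<forall>i\<in>{1..n}. D y i m) \<and> D y (Suc n) p" if "p \<le> m" for p
      using that
    proof (induction p)
      case 0
      then show ?case using Suc by (auto simp: D_def)
    next
      case (Suc p)
      then obtain y where y: "P y" "\<forall>i\<in>{1..n}. D y i m" "D y (Suc n) p" by auto
      show ?case
      proof (cases "Suc n < Suc p")
        case False
        with y show ?thesis by (auto simp: D_def)
      next
        case True
        let ?z = "comparator (Suc n) (Suc p) y"
        have "P ?z" using y(1) True Suc.prems by (intro step) auto
        \<comment> \<open>The gate changes only entries after \<open>i\<close>, and an upper bound
          of two entries also bounds their supremum and infimum.\<close>
        moreover have "D ?z i m" if i: "i \<in> {1..n}" for i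
        proof -
          have "y j \<le> y i" if "j \<in> {1..m}" "i < j" for j
            using y(2) i that by (auto simp: D_def)
          then show ?thesis
            using i True Suc.prems by (auto simp: D_def comparator_def intro: le_infI1)
        qed
        moreover have "D ?z (Suc n) (Suc p)"
          using y(3) True by (auto simp: D_def comparator_def le_Suc_eq intro: le_supI1 le_infI1)
        ultimately show ?thesis by blast
      qed
    qed
    from this[of m] obtain y where y: "P y" "\<forall>i\<in>{1..n}. D y i m" "D y (Suc n) m" by auto
    then have "\<forall>i\<in>{1..Suc n}. D y i m" by (simp add: atLeastAtMostSuc_conv)
    with y(1) show ?case by blast
  qed
  from this[of m] obtain y where "P y" "\<forall>i\<in>{1..m}. D y i m" by auto
  then show thesis
    by (intro that[of y]) (auto simp: monotone_on_def D_def le_less)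
qed

section \<open>The elements \<open>J m k x\<close> and comparators\<close>

lemma index_set_finite:
  assumes "I \<subseteq> {1..m}" "card I = k" "1 \<le> k"
  shows "finite I" "I \<noteq> {}"
  using assms by (auto intro: card_ge_0_finite)

lemma card_insert_remove_eq:
  assumes "finite I" "i \<in> I" "j \<notin> I"
  shows "card (insert j (I - {i})) = card I"
  using assms card.remove[of I i] by simp

text \<open>The bounds on \<open>k\<close> make \<open>{1..k}\<close> an admissible index set, so
  that \<open>Sup_fin\<close> is taken over a nonempty set.\<close>

lemma J_le_iff:
  fixes x :: "nat \<Rightarrow> 'a::lattice"
  assumes "1 \<le> k" "k \<le> m"
  shows "J m k x \<le> c \<longleftrightarrow> (\<forall>I. I \<subseteq> {1..m} \<longrightarrow> card I = k \<longrightarrow> Inf_fin (x ` I) \<le> c)"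
proof -
  let ?S = "{I. I \<subseteq> {1..m} \<and> card I = k}"
  have "{1..k} \<in> ?S" using assms by auto
  then have "(\<lambda>I. Inf_fin (x ` I)) ` ?S \<noteq> {}" by blast
  moreover have "finite ((\<lambda>I. Inf_fin (x ` I)) ` ?S)" by simp
  ultimately show ?thesis
    unfolding J_def by (subst Sup_fin.bounded_iff) auto
qed

lemma Inf_fin_le_J:
  fixes x :: "nat \<Rightarrow> 'a::lattice"
  assumes "I \<subseteq> {1..m}" "card I = k" "1 \<le> k"
  shows "Inf_fin (x ` I) \<le> J m k x"
proof -
  have "k \<le> m" using card_mono[of "{1..m}" I] assms by simp
  with J_le_iff[of k m x "J m k x"] assms show ?thesis by auto
qed

text \<open>A \<open>k\<close>-element set of positive indices does not fit below \<open>k\<close>,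
  so it has an index at least \<open>k\<close> and its infimum is at most \<open>x k\<close>. The
  set \<open>{1..k}\<close> attains this bound.\<close>

lemma J_antimono:
  fixes x :: "nat \<Rightarrow> 'a::lattice"
  assumes x: "antimono_on {1..m} x" and k: "k \<in> {1..m}"
  shows "J m k x = x k"
proof (rule order.antisym)
  have "Inf_fin (x ` I) \<le> x k" if I: "I \<subseteq> {1..m}" "card I = k" for I
  proof -
    have "\<not> I \<subseteq> {1..<k}" using card_mono[of "{1..<k}" I] I k by auto
    then obtain i where i: "i \<in> I" "k \<le> i" using I by force
    have "Inf_fin (x ` I) \<le> x i" using i I finite_subset by (intro Inf_fin.coboundedI) auto
    also have "x i \<le> x k" using x i I k by (auto simp: monotone_on_def)
    finally show ?thesis .
  qed
  then show "J m k x \<le> x k" using k by (simp add: J_le_iff)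
  have "x k \<le> Inf_fin (x ` {1..k})"
    using k x by (subst Inf_fin.bounded_iff) (auto simp: monotone_on_def)
  also have "\<dots> \<le> J m k x" using k by (intro Inf_fin_le_J) auto
  finally show "x k \<le> J m k x" .
qed

text \<open>From \<open>a + d = inf a d + sup a d\<close>, each \<open>d\<close> is
  \<open>inf a d\<close> plus the excess \<open>sup a d - a\<close>. Enlarging the excess to that of
  \<open>sup b c\<close> gives one bound for both \<open>b\<close> and \<open>c\<close>, hence for
  their supremum; subtracting the excess yields the claim.\<close>

lemma inf_sup_distrib_lattice_group:
  fixes a b c :: "'a::lattice_ab_group_add"
  shows "inf a (sup b c) = sup (inf a b) (inf a c)"
proof (rule order.antisym)
  let ?r = "sup (inf a b) (inf a c)"
  have *: "d \<le> ?r + (sup a (sup b c) - a)" if "inf a d \<le> ?r" "d \<le> sup b c" for d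
  proof -
    have "d = inf a d + (sup a d - a)" using add_eq_inf_sup[of a d] by (simp add: algebra_simps)
    also have "\<dots> \<le> ?r + (sup a (sup b c) - a)"
      using that by (intro add_mono diff_right_mono sup_mono) auto
    finally show ?thesis .
  qed
  have "sup b c \<le> ?r + (sup a (sup b c) - a)"
    by (intro sup_least *) auto
  moreover have "inf a (sup b c) = sup b c - (sup a (sup b c) - a)"
    using add_eq_inf_sup[of a "sup b c"]
    by (simp add: algebra_simps del: diff_sup_eq_inf)
  ultimately show "inf a (sup b c) \<le> ?r" by (simp only: diff_le_eq)
  show "?r \<le> inf a (sup b c)" by (auto intro: le_infI2)
qed

lemma J_comparator:
  fixes x :: "nat \<Rightarrow> 'a::lattice_ab_group_add"
  assumes ij: "i \<in> {1..m}" "j \<in> {1..m}" "i \<noteq> j" and k: "k \<in> {1..m}"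
  shows "J m k (comparator i j x) = J m k x"
proof -
  let ?z = "comparator i j x"
  define swap where "swap I = insert i (I - {j})" for I
  have z: "?z i = sup (x i) (x j)" "?z j = inf (x i) (x j)" "\<And>l. l \<noteq> i \<Longrightarrow> l \<noteq> j \<Longrightarrow> ?z l = x l"
    using ij by (auto simp: comparator_def)
  show ?thesis
  proof (rule order.antisym)
    have "Inf_fin (?z ` I) \<le> J m k x" if I: "I \<subseteq> {1..m}" "card I = k" for I
    proof -
      have fin: "finite I" "I \<noteq> {}" using index_set_finite[OF I] k by auto
      have lower: "Inf_fin (?z ` I) \<le> ?z l" if "l \<in> I" for l
        using that fin by (intro Inf_fin.coboundedI) auto
      show ?thesis
      \<comment> \<open>Only an index set with \<open>i\<close> and without \<open>j\<close> sees
        the supremum alone. Distributivity splits its infimum into two pieces, bounded by the infima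
        of \<open>x\<close> over \<open>I\<close> and over \<open>I\<close> with \<open>i\<close>
        exchanged for \<open>j\<close>.\<close>
      proof (cases "i \<in> I \<and> j \<notin> I")
        case True
        define I' where "I' = insert j (I - {i})"
        have I': "I' \<subseteq> {1..m}" "card I' = k" using I ij True fin by (auto simp: I'_def card_insert_remove_eq simp del: card_insert_disjoint)
        have bounds: "inf (Inf_fin (?z ` I)) (x i) \<le> Inf_fin (x ` I)"
          "inf (Inf_fin (?z ` I)) (x j) \<le> Inf_fin (x ` I')"
        proof -
          have *: "Inf_fin (?z ` I) \<le> x l" if "l \<in> I - {i}" for l
            using lower[of l] z(3)[of l] True that by (metis DiffD1 DiffD2 singletonI)
          have "inf (Inf_fin (?z ` I)) (x i) \<le> x l" if "l \<in> I" for l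
            using * that by (cases "l = i") (auto intro: le_infI1)
          then show "inf (Inf_fin (?z ` I)) (x i) \<le> Inf_fin (x ` I)"
            using fin by (subst Inf_fin.bounded_iff) auto
          have "inf (Inf_fin (?z ` I)) (x j) \<le> x l" if "l \<in> I'" for l
            using * that by (cases "l = j") (auto simp: I'_def intro: le_infI1)
          then show "inf (Inf_fin (?z ` I)) (x j) \<le> Inf_fin (x ` I')"
            using fin by (subst Inf_fin.bounded_iff) (auto simp: I'_def)
        qed
        have "Inf_fin (?z ` I) = inf (Inf_fin (?z ` I)) (sup (x i) (x j))"
          using lower[of i] True z by (simp add: inf_absorb1)
        also have "\<dots> = sup (inf (Inf_fin (?z ` I)) (x i)) (inf (Inf_fin (?z ` I)) (x j))"
          by (rule inf_sup_distrib_lattice_group)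
        also have "\<dots> \<le> J m k x"
          using bounds Inf_fin_le_J[OF I, of x] Inf_fin_le_J[OF I', of x] k
          by (intro sup_least) (auto intro: order_trans)
        finally show ?thesis .
      next
        case False
        have "Inf_fin (?z ` I) \<le> x l" if l: "l \<in> I" for l
        proof -
          consider "l \<noteq> i" "l \<noteq> j" | "l = i" "j \<in> I" | "l = j" using False l by blast
          then show ?thesis
            using lower[of l] lower[of j] l z by cases auto
        qed
        then have "Inf_fin (?z ` I) \<le> Inf_fin (x ` I)"
          using fin by (subst Inf_fin.bounded_iff) auto
        also have "\<dots> \<le> J m k x" using Inf_fin_le_J[OF I, of x] k by simp
        finally show ?thesis .
      qed
    qed
    then show "J m k ?z \<le> J m k x" using k by (simp add: J_le_iff)
  next
    have "Inf_fin (x ` I) \<le> J m k ?z" if I: "I \<subseteq> {1..m}" "card I = k" for I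
    proof -
      have fin: "finite I" "I \<noteq> {}" using index_set_finite[OF I] k by auto
      have lower: "Inf_fin (x ` I) \<le> x l" if "l \<in> I" for l
        using that fin by (intro Inf_fin.coboundedI) auto
      \<comment> \<open>If \<open>I\<close> has \<open>j\<close> without \<open>i\<close>, the entry
        at \<open>j\<close> may have become too small, whereas the new entry at \<open>i\<close>
        dominates \<open>x j\<close>. Otherwise \<open>I\<close> itself serves.\<close>
      define I' where "I' = (if j \<in> I \<and> i \<notin> I then insert i (I - {j}) else I)"
      have I': "I' \<subseteq> {1..m}" "card I' = k" using I ij fin by (auto simp: I'_def card_insert_remove_eq simp del: card_insert_disjoint)
      have fin': "finite I'" "I' \<noteq> {}" using index_set_finite[OF I'] k by auto
      have "Inf_fin (x ` I) \<le> ?z l" if l: "l \<in> I'" for l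
      proof -
        consider "l \<noteq> i" "l \<noteq> j" "l \<in> I" | "l = i" "i \<in> I" | "l = i" "j \<in> I"
          | "l = j" "i \<in> I" "j \<in> I"
          using l by (auto simp: I'_def split: if_splits)
        then show ?thesis
          using lower[of l] lower[of i] lower[of j] z by cases (auto intro: le_supI1 le_supI2)
      qed
      then have "Inf_fin (x ` I) \<le> Inf_fin (?z ` I')"
        using fin' by (subst Inf_fin.bounded_iff) auto
      also have "\<dots> \<le> J m k ?z" using Inf_fin_le_J[OF I', of ?z] k by simp
      finally show ?thesis .
    qed
    then show "J m k x \<le> J m k ?z" using k by (simp add: J_le_iff)
  qed
qed

section \<open>Multilinear forms\<close>

lemma fun_upd_power_space:
  assumes "x \<in> power_space m" "i \<in> {1..m}"
  shows "x(i := t) \<in> power_space m"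
  using assms by (auto simp: power_space_def PiE_def extensional_def)

text \<open>Reduces a claim about tuples of arbitrary sign to nonnegative ones, one argument at a
  time, without expanding into \<open>2 ^ m\<close> terms. The induction runs over a set of indices
  that contains all those whose argument may fail to be nonnegative.\<close>

lemma pprt_induct [consumes 1, case_names nonneg split]:
  fixes x :: "nat \<Rightarrow> 'a::lattice_ab_group_add"
  assumes x: "x \<in> power_space m"
    and nonneg: "\<And>x. x \<in> power_space m \<Longrightarrow> \<forall>i\<in>{1..m}. 0 \<le> x i \<Longrightarrow> Q x"
    and split: "\<And>x i. x \<in> power_space m \<Longrightarrow> i \<in> {1..m} \<Longrightarrow>
      Q (x(i := pprt (x i))) \<Longrightarrow> Q (x(i := pprt (- x i))) \<Longrightarrow> Q x"
  shows "Q x"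
proof -
  have "Q x" if "x \<in> power_space m" "finite S" "S \<subseteq> {1..m}" "\<forall>i\<in>{1..m} - S. 0 \<le> x i" for S x
    using that(2,1,3,4)
  proof (induction S arbitrary: x rule: finite_induct)
    case empty
    then show ?case by (auto intro: nonneg)
  next
    case (insert i S)
    have "Q (x(i := t))" if "0 \<le> t" for t
      using insert that by (intro insert.IH fun_upd_power_space) auto
    then show ?case using insert.prems by (intro split[of x i]) auto
  qed
  from this[of x "{1..m}"] x show ?thesis by auto
qed

lemma regular_form_multilinear:
  fixes A :: "(nat \<Rightarrow> 'a::banach_lattice) \<Rightarrow> real"
  assumes "regular_form m A"
  shows "multilinear_form m A"
  unfolding multilinear_form_def
proof (intro ballI)
  fix x :: "nat \<Rightarrow> 'a" and i assume x: "x \<in> power_space m" and i: "i \<in> {1..m}"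
  obtain P Q where "positive_form m P" "positive_form m Q" "\<forall>x\<in>power_space m. A x = P x - Q x"
    using assms by (auto simp: regular_form_def)
  then show "linear (\<lambda>t. A (x(i := t)))"
    using fun_upd_power_space[OF x i] x i
    by (auto simp: positive_form_def multilinear_form_def intro!: linear_compose_sub)
qed

lemma multilinear_form_split:
  fixes A :: "(nat \<Rightarrow> 'a::{real_vector, lattice_ab_group_add}) \<Rightarrow> real"
  assumes "multilinear_form m A" "x \<in> power_space m" "i \<in> {1..m}"
  shows "A x = A (x(i := pprt (x i))) - A (x(i := pprt (- x i)))"
proof -
  have lin: "linear (\<lambda>t. A (x(i := t)))" using assms by (auto simp: multilinear_form_def)
  have "x i = pprt (x i) - pprt (- x i)" using prts[of "x i"] by (simp add: pprt_neg)
  then have "x = x(i := pprt (x i) - pprt (- x i))" by auto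
  then have "A x = A (x(i := pprt (x i) - pprt (- x i)))" by simp
  also have "\<dots> = A (x(i := pprt (x i))) - A (x(i := pprt (- x i)))"
    by (rule linear_diff[OF lin])
  finally show ?thesis .
qed

text \<open>Splitting an argument costs one triangle inequality, and the two resulting bounds add up
  exactly because the modulus is the sum of the positive and the negative part.\<close>

lemma positive_form_abs_le:
  fixes P :: "(nat \<Rightarrow> 'a::banach_lattice) \<Rightarrow> real"
  assumes P: "positive_form m P" and "x \<in> power_space m"
  shows "\<bar>P x\<bar> \<le> P (\<lambda>l\<in>{1..m}. \<bar>x l\<bar>)"
  using assms(2)
proof (induction x rule: pprt_induct)
  case (nonneg x)
  then have "(\<lambda>l\<in>{1..m}. \<bar>x l\<bar>) = x"
    by (auto simp: power_space_def PiE_def extensional_def)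
  then show ?case using nonneg P by (simp add: positive_form_def)
next
  case (split x i)
  let ?a = "\<lambda>l\<in>{1..m}. \<bar>x l\<bar>"
  have mult: "multilinear_form m P" using P by (simp add: positive_form_def)
  have a: "?a \<in> power_space m" by (auto simp: power_space_def)
  then have lin: "linear (\<lambda>t. P (?a(i := t)))" using mult split(2) by (auto simp: multilinear_form_def)
  have upd: "(\<lambda>l\<in>{1..m}. \<bar>(x(i := t)) l\<bar>) = ?a(i := t)" if "0 \<le> t" for t
    using split(2) that by auto
  have "\<bar>P x\<bar> \<le> \<bar>P (x(i := pprt (x i)))\<bar> + \<bar>P (x(i := pprt (- x i)))\<bar>"
    using multilinear_form_split[OF mult split(1,2)] by linarith
  also have "\<dots> \<le> P (?a(i := pprt (x i))) + P (?a(i := pprt (- x i)))"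
    using split(3,4) by (simp only: upd zero_le_pprt add_mono)
  also have "\<dots> = P (?a(i := pprt (x i) + pprt (- x i)))"
    by (rule linear_add[OF lin, symmetric])
  also have "?a(i := pprt (x i) + pprt (- x i)) = ?a"
    using split(2) by (auto simp: abs_prts pprt_neg)
  finally show ?case .
qed

text \<open>Freezing all arguments except \<open>i\<close> and \<open>j\<close> leaves a bilinear
  form, to which the bilinear result applies.\<close>

lemma orthosymmetric_comparator:
  fixes A :: "(nat \<Rightarrow> 'a::banach_lattice) \<Rightarrow> real"
  assumes A: "orthosymmetric m A" and x: "x \<in> power_space m"
    and ij: "i \<in> {1..m}" "j \<in> {1..m}" "i \<noteq> j"
  shows "A (comparator i j x) = A x"
proof -
  have reg: "regular_form m A" using A by (simp add: orthosymmetric_def)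
  then obtain P Q where PQ: "positive_form m P" "positive_form m Q"
      "\<forall>x\<in>power_space m. A x = P x - Q x"
    by (auto simp: regular_form_def)
  let ?a = "\<lambda>l\<in>{1..m}. \<bar>x l\<bar>"
  have a: "?a \<in> power_space m" by (auto simp: power_space_def)
  define B where "B s t = A (x(i := s, j := t))" for s t
  define R where "R s t = P (?a(i := s, j := t)) + Q (?a(i := s, j := t))" for s t
  have lin2: "linear (\<lambda>t. F (z(i := s, j := t)))" "linear (\<lambda>t. F (z(i := t, j := s)))"
    if "multilinear_form m F" "z \<in> power_space m" for F :: "(nat \<Rightarrow> 'a) \<Rightarrow> real" and z s
  proof -
    show "linear (\<lambda>t. F (z(i := s, j := t)))"
      using that ij fun_upd_power_space[of z m i s] by (auto simp: multilinear_form_def)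
    show "linear (\<lambda>t. F (z(i := t, j := s)))"
      using that ij fun_upd_power_space[of z m j s]
      by (auto simp: multilinear_form_def fun_upd_twist[OF ij(3)])
  qed
  have B: "linear (B s)" "linear (\<lambda>s. B s t)" for s t
    unfolding B_def using lin2 regular_form_multilinear[OF reg] x by auto
  have R: "linear (R s)" "linear (\<lambda>s. R s t)" for s t
    unfolding R_def using lin2 PQ a by (auto simp: positive_form_def intro!: linear_compose_add)
  have "B (sup (x i) (x j)) (inf (x i) (x j)) = B (x i) (x j)"
  proof (rule orthosymmetric_bilinear_sup_inf[OF B R])
    fix s t :: 'a assume st: "0 \<le> s" "0 \<le> t"
    let ?z = "x(i := s, j := t)"
    have z: "?z \<in> power_space m" using x ij by (intro fun_upd_power_space)
    have "(\<lambda>l\<in>{1..m}. \<bar>?z l\<bar>) = ?a(i := s, j := t)"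
      using ij st by auto
    then have "\<bar>P ?z\<bar> + \<bar>Q ?z\<bar> \<le> R s t"
      using positive_form_abs_le[OF PQ(1) z] positive_form_abs_le[OF PQ(2) z] by (simp add: R_def)
    moreover have "A ?z = P ?z - Q ?z" using PQ(3) z by blast
    ultimately show "\<bar>B s t\<bar> \<le> R s t" unfolding B_def by linarith
    assume "inf s t = 0"
    then have "lattice_disjoint (?z i) (?z j)"
      using st ij by (simp add: lattice_disjoint_def)
    then show "B s t = 0"
      using A z ij unfolding B_def orthosymmetric_def by blast
  qed
  then show ?thesis by (simp add: B_def comparator_def)
qed

section \<open>The two directions of the equivalence\<close>

lemma orthosymmetric_eq_J:
  fixes A :: "(nat \<Rightarrow> 'a::banach_lattice) \<Rightarrow> real"
  assumes A: "orthosymmetric m A" and x: "x \<in> power_space m"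
  shows "A x = A (\<lambda>k\<in>{1..m}. J m k x)"
proof -
  define P where "P y \<longleftrightarrow> y \<in> power_space m \<and> A y = A x \<and> (\<forall>k\<in>{1..m}. J m k y = J m k x)" for y
  obtain y where y: "P y" "antimono_on {1..m} y"
  proof (rule comparator_sorting[of P x m])
    show "P x" using x by (simp add: P_def)
    fix y i j assume *: "P y" "i \<in> {1..m}" "j \<in> {1..m}" "i < j"
    then have "comparator i j y \<in> power_space m"
      unfolding comparator_def by (intro fun_upd_power_space) (auto simp: P_def)
    with * show "P (comparator i j y)"
      using orthosymmetric_comparator[OF A, of y i j] J_comparator[of i m j _ y]
      by (simp add: P_def)
  qed
  \<comment> \<open>A decreasing tuple consists of its own \<open>J m k y\<close>; outside
    \<open>{1..m}\<close> both sides are \<open>undefined\<close>.\<close>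
  have "y = (\<lambda>k\<in>{1..m}. J m k y)"
    using y by (auto simp: P_def J_antimono power_space_def PiE_def extensional_def)
  also have "\<dots> = (\<lambda>k\<in>{1..m}. J m k x)"
    using y(1) by (auto simp: P_def)
  finally show ?thesis using y(1) by (auto simp: P_def)
qed

text \<open>With negative arguments \<open>J m m x\<close> can be nonzero although two arguments are
  disjoint, so vanishing is first shown for nonnegative tuples and then extended by
  splitting.\<close>

lemma orthosymmetric_if_eq_J:
  fixes A :: "(nat \<Rightarrow> 'a::banach_lattice) \<Rightarrow> real"
  assumes reg: "regular_form m A"
    and eq: "\<forall>x\<in>power_space m. A x = A (\<lambda>k\<in>{1..m}. J m k x)"
  shows "orthosymmetric m A"
proof -
  note mult = regular_form_multilinear[OF reg]
  have "A x = 0" if x: "x \<in> power_space m" and ij: "i \<in> {1..m}" "j \<in> {1..m}" "i \<noteq> j"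
    and "inf \<bar>x i\<bar> \<bar>x j\<bar> = 0" for x i j
    using x that(5)
  proof (induction x rule: pprt_induct)
    case (nonneg x)
    let ?y = "\<lambda>k\<in>{1..m}. J m k x"
    have m: "1 \<le> m" using ij by simp
    have "J m m x = 0"
    proof (rule order.antisym)
      have "Inf_fin (x ` I) \<le> 0" if I: "I \<subseteq> {1..m}" "card I = m" for I
      proof -
        have "I = {1..m}" using I by (simp add: card_subset_eq)
        then have "Inf_fin (x ` I) \<le> inf (x i) (x j)"
          using ij by (auto intro!: Inf_fin.coboundedI)
        also have "\<dots> = 0" using nonneg ij by simp
        finally show ?thesis .
      qed
      then show "J m m x \<le> 0" using m by (simp add: J_le_iff)
      have "0 \<le> Inf_fin (x ` {1..m})" using nonneg m by (subst Inf_fin.bounded_iff) auto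
      also have "\<dots> \<le> J m m x" using m by (intro Inf_fin_le_J) auto
      finally show "0 \<le> J m m x" .
    qed
    \<comment> \<open>Writing the zero entry as an update exposes the slot \<open>m\<close> in which
      linearity forces the value \<open>0\<close>.\<close>
    then have y: "?y = ?y(m := 0)" using m by auto
    have "?y \<in> power_space m" by (auto simp: power_space_def)
    then have "linear (\<lambda>t. A (?y(m := t)))" using mult m by (auto simp: multilinear_form_def)
    from linear_0[OF this] y have "A ?y = 0" by simp
    then show ?case using eq nonneg(1) by simp
  next
    case (split x l)
    \<comment> \<open>Shrinking the modulus of an argument preserves disjointness, so both parts of
      \<open>x l\<close> satisfy the induction hypothesis.\<close>
    have disj: "inf \<bar>(x(l := t)) i\<bar> \<bar>(x(l := t)) j\<bar> = 0" if "\<bar>t\<bar> \<le> \<bar>x l\<bar>" for t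
      using that by (intro inf_eq_0_mono[OF split(5)]) auto
    have "\<bar>pprt (x l)\<bar> \<le> \<bar>x l\<bar>" "\<bar>pprt (- x l)\<bar> \<le> \<bar>x l\<bar>"
      by (simp_all add: abs_prts[of "x l"] pprt_neg)
    then have "A (x(l := pprt (x l))) = 0" "A (x(l := pprt (- x l))) = 0"
      by (auto intro!: split(3,4) disj simp del: fun_upd_apply)
    then show ?case
      using multilinear_form_split[OF mult split(1,2)] by linarith
  qed
  then show ?thesis using reg by (auto simp: orthosymmetric_def lattice_disjoint_def)
qed

theorem proposition2:
  fixes A :: "(nat \<Rightarrow> 'a::banach_lattice) \<Rightarrow> real" and m :: nat
  assumes "m \<ge> 2" and "regular_form m A"
  shows "orthosymmetric m A \<longleftrightarrow>
    (\<forall>x\<in>power_space m. A x = A (\<lambda>k\<in>{1..m}. J m k x))"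
  using orthosymmetric_eq_J[of m A] orthosymmetric_if_eq_J[OF assms(2)] by blast

end
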